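(* Let $G$ be a group, let $n\ge 1$, and let $G=A_1\cup\dots\cup A_n$ be a partition of $G$. Then either $\mathrm{cov}(A_iA_i^{-1})\le n$ for all $i\in\{1,\dots,n\}$, or else $\mathrm{cov}(A_iA_i^{-1}A_i)<n$ for some $i\in\{1,\dots,n\}$.
   Context: For subsets $S,T$ of a group $G$: $ST=\{st:s\in S,\ t\in T\}$ and $S^{-1}=\{s^{-1}:s\in S\}$. For a non-empty $A\subset G$, the covering number is $\mathrm{cov}(A)=\min\{|F|:F\subset G,\ G=FA\}$; and $\mathrm{cov}(\emptyset)=\infty$, larger than any cardinal. *)

theory Defs
  imports "HOL-Algebra.Coset" "HOL-Library.Disjoint_Sets"
begin

unbundle cardinal_syntax

definition covers :: "('a, 'b) monoid_scheme \<Rightarrow> 'a set \<Rightarrow> 'a set set" where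
  "covers G A = {F. F \<subseteq> carrier G \<and> carrier G = F <#>\<^bsub>G\<^esub> A}"

(* The value None stands for infinity, a value larger than every cardinal; Some r is a genuine,
   possibly infinite, cardinal, represented by a cardinal order r and determined up to =o.
   The minimum in the second branch exists by covering_number_min below. *)
definition covering_number :: "('a, 'b) monoid_scheme \<Rightarrow> 'a set \<Rightarrow> 'a rel option" where
  "covering_number G A =
     (if A = {} then None
      else Some (SOME r. r \<in> card_of ` covers G A \<and> (\<forall>F\<in>covers G A. r \<le>o |F| )))"

definition card_at_most :: "'a rel option \<Rightarrow> nat \<Rightarrow> bool" where
  "card_at_most c n = (case c of None \<Rightarrow> False | Some r \<Rightarrow> r \<le>o |{..<n}| )"

definition card_less_than :: "'a rel option \<Rightarrow> nat \<Rightarrow> bool" where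
  "card_less_than c n = (case c of None \<Rightarrow> False | Some r \<Rightarrow> r <o |{..<n}| )"

lemma carrier_in_covers:
  assumes "group G" and "A \<subseteq> carrier G" and "A \<noteq> {}"
  shows "carrier G \<in> covers G A"
proof -
  interpret group G by fact
  obtain a where a: "a \<in> A" "a \<in> carrier G" using assms by blast
  have "x \<in> carrier G <#>\<^bsub>G\<^esub> A" if x: "x \<in> carrier G" for x
  proof -
    have "x = (x \<otimes>\<^bsub>G\<^esub> inv\<^bsub>G\<^esub> a) \<otimes>\<^bsub>G\<^esub> a"
      using a x by (simp add: m_assoc)
    then show ?thesis
      using a x unfolding set_mult_def by blast
  qed
  moreover have "carrier G <#>\<^bsub>G\<^esub> A \<subseteq> carrier G"
    using assms(2) by (auto simp: set_mult_def)
  ultimately show ?thesis by (auto simp: covers_def)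
qed

lemma covering_number_min:
  assumes "group G" and "A \<subseteq> carrier G" and "A \<noteq> {}"
  obtains F where "F \<in> covers G A" "covering_number G A = Some |F|"
    "\<And>F'. F' \<in> covers G A \<Longrightarrow> |F| \<le>o |F'|"
proof -
  let ?P = "\<lambda>r. r \<in> card_of ` covers G A \<and> (\<forall>F\<in>covers G A. r \<le>o |F| )"
  have "\<exists>r \<in> card_of ` covers G A. \<forall>r' \<in> card_of ` covers G A. r \<le>o r'"
    using carrier_in_covers[OF assms]
    by (intro exists_minim_Card_order) (auto simp: card_of_Card_order)
  then have "\<exists>r. ?P r" by auto
  then have P: "?P (SOME r. ?P r)" by (rule someI_ex)
  then obtain F where F: "F \<in> covers G A" "(SOME r. ?P r) = |F|" by blast
  have "covering_number G A = Some |F|"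
    unfolding covering_number_def F(2)[symmetric] using assms(3) by simp
  moreover have "|F| \<le>o |F'|" if "F' \<in> covers G A" for F'
    using P that unfolding F(2) by blast
  ultimately show ?thesis using that F(1) by blast
qed

lemma card_of_le_nat_iff: "|F| \<le>o |{..<n::nat}| \<longleftrightarrow> finite F \<and> card F \<le> n"
proof
  assume le: "|F| \<le>o |{..<n}|"
  then obtain f where "inj_on f F" "f ` F \<subseteq> {..<n}"
    by (auto simp: card_of_ordLeq[symmetric])
  then show "finite F \<and> card F \<le> n"
    using card_inj_on_le[of f F "{..<n}"] inj_on_finite[of f F "{..<n}"] by simp
next
  assume "finite F \<and> card F \<le> n"
  then have "\<exists>f. f ` F \<subseteq> {..<n} \<and> inj_on f F"
    using card_le_inj[of F "{..<n}"] by simp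
  then show "|F| \<le>o |{..<n}|"
    by (auto simp: card_of_ordLeq[symmetric])
qed

lemma card_of_less_nat_iff: "|F| <o |{..<n::nat}| \<longleftrightarrow> finite F \<and> card F < n"
proof -
  have ge: "|{..<n}| \<le>o |F| \<longleftrightarrow> (finite F \<longrightarrow> n \<le> card F)"
  proof
    assume "|{..<n}| \<le>o |F|"
    then obtain f where "inj_on f {..<n}" "f ` {..<n} \<subseteq> F"
      by (auto simp: card_of_ordLeq[symmetric])
    then show "finite F \<longrightarrow> n \<le> card F"
      using card_inj_on_le[of f "{..<n}" F] by simp
  next
    assume A: "finite F \<longrightarrow> n \<le> card F"
    obtain B where "B \<subseteq> F" "finite B" "card B = n"
      using A obtain_subset_with_card_n[of n F] infinite_arbitrarily_large[of F n]
      by (cases "finite F") auto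
    then have "\<exists>f. f ` {..<n} \<subseteq> B \<and> inj_on f {..<n}"
      using card_le_inj[of "{..<n}" B] by simp
    then show "|{..<n}| \<le>o |F|"
      using \<open>B \<subseteq> F\<close> card_of_ordLeq[of "{..<n}" F] by blast
  qed
  show ?thesis
    using ge not_ordLeq_iff_ordLess[OF card_of_Well_order card_of_Well_order, of "{..<n}" F]
    by auto
qed

lemma card_at_most_covering_number_iff:
  assumes "group G" and "A \<subseteq> carrier G" and "A \<noteq> {}"
  shows "card_at_most (covering_number G A) n \<longleftrightarrow>
    (\<exists>F. F \<subseteq> carrier G \<and> carrier G = F <#>\<^bsub>G\<^esub> A \<and> finite F \<and> card F \<le> n)"
proof -
  obtain F where F: "F \<in> covers G A" "covering_number G A = Some |F|"
    and min: "\<And>F'. F' \<in> covers G A \<Longrightarrow> |F| \<le>o |F'|"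
    using covering_number_min[OF assms] by blast
  have "card_at_most (covering_number G A) n \<longleftrightarrow> (\<exists>F'\<in>covers G A. |F'| \<le>o |{..<n}| )"
    using F min[THEN ordLeq_transitive] by (auto simp: card_at_most_def)
  then show ?thesis by (auto simp: card_of_le_nat_iff covers_def)
qed

lemma card_less_than_covering_number_iff:
  assumes "group G" and "A \<subseteq> carrier G" and "A \<noteq> {}"
  shows "card_less_than (covering_number G A) n \<longleftrightarrow>
    (\<exists>F. F \<subseteq> carrier G \<and> carrier G = F <#>\<^bsub>G\<^esub> A \<and> finite F \<and> card F < n)"
proof -
  obtain F where F: "F \<in> covers G A" "covering_number G A = Some |F|"
    and min: "\<And>F'. F' \<in> covers G A \<Longrightarrow> |F| \<le>o |F'|"
    using covering_number_min[OF assms] by blast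
  have "card_less_than (covering_number G A) n \<longleftrightarrow> (\<exists>F'\<in>covers G A. |F'| <o |{..<n}| )"
    using F min[THEN ordLeq_ordLess_trans] by (auto simp: card_less_than_def)
  then show ?thesis by (auto simp: card_of_less_nat_iff covers_def)
qed

end

theory Submission
  imports Defs Complex_Main
begin

text \<open>Let \<open>m\<close> be a finitely additive probability on \<open>G\<close> such that \<open>m (t A) > 1/N\<close> for all \<open>t \<in> T\<close>.
Then fewer than \<open>N\<close> of the sets \<open>t A\<close> are pairwise disjoint, so a maximal disjoint family gives
\<open>T \<subseteq> X A A\<^sup>-\<^sup>1\<close> with \<open>|X| < N\<close>.
Suppose that for no \<open>m\<close> and no \<open>j\<close> the set \<open>T = {t. m (t A\<^sub>j) > 1/n}\<close> satisfies \<open>T A\<^sub>j = G\<close>. Given \<open>m\<close>,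
pick \<open>g \<notin> T A\<^sub>j\<close>. The convolution of \<open>m\<close>, the point mass at \<open>g\<^sup>-\<^sup>1\<close> and \<open>m\<close> is small on \<open>t A\<^sub>j\<close> where
\<open>m (t A\<^sub>j)\<close> is large, so mixing it with \<open>m\<close> lowers \<open>sup\<^sub>t m (t A\<^sub>j)\<close> as long as this supremum exceeds \<open>1/n\<close>.
Convolution from the left preserves uniform bounds on \<open>m (t A\<^sub>k)\<close>, so the cells can be treated
one after the other: some \<open>m\<close> satisfies \<open>m (t A\<^sub>j) \<le> 1/n + \<epsilon>\<close> for all \<open>t\<close> and all \<open>j\<close> other than \<open>i\<close>, hence
\<open>m (t A\<^sub>i) > 1/(n+1)\<close> for all \<open>t\<close>.\<close>

section \<open>Finitely additive means\<close>

context group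
begin

text \<open>Positivity is tested on the carrier only, so a mean ignores the values of \<open>f\<close> outside it. Since
\<open>f\<close> is not assumed bounded, only means of finite support may exist; these suffice.\<close>

definition mean :: "(('a \<Rightarrow> real) \<Rightarrow> real) \<Rightarrow> bool" where
  "mean m \<longleftrightarrow> (\<forall>f g. m (\<lambda>x. f x + g x) = m f + m g) \<and> (\<forall>c f. m (\<lambda>x. c * f x) = c * m f) \<and>
     (\<forall>f. (\<forall>x\<in>carrier G. 0 \<le> f x) \<longrightarrow> 0 \<le> m f) \<and> m (\<lambda>x. 1) = 1"

lemma mean_add: "mean m \<Longrightarrow> m (\<lambda>x. f x + g x) = m f + m g"
  by (simp add: mean_def)

lemma mean_scale: "mean m \<Longrightarrow> m (\<lambda>x. c * f x) = c * m f"
  by (simp add: mean_def)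

lemma mean_const: "mean m \<Longrightarrow> m (\<lambda>x. c) = c"
  using mean_scale[of m c "\<lambda>x. 1"] by (simp add: mean_def)

lemma mean_diff: "mean m \<Longrightarrow> m (\<lambda>x. f x - g x) = m f - m g"
  using mean_add[of m f "\<lambda>x. -1 * g x"] mean_scale[of m "-1" g] by simp

lemma mean_mono:
  assumes "mean m" and "\<And>x. x \<in> carrier G \<Longrightarrow> f x \<le> g x"
  shows "m f \<le> m g"
proof -
  have "0 \<le> m (\<lambda>x. g x - f x)"
    using assms by (simp add: mean_def)
  then show ?thesis by (simp add: mean_diff[OF assms(1)])
qed

lemma mean_cong:
  assumes "mean m" and "\<And>x. x \<in> carrier G \<Longrightarrow> f x = g x"
  shows "m f = m g"
  using mean_mono[OF assms(1), of f g] mean_mono[OF assms(1), of g f] assms(2) by fastforce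

lemma mean_sum:
  assumes "mean m" and "finite I"
  shows "m (\<lambda>x. \<Sum>i\<in>I. f i x) = (\<Sum>i\<in>I. m (f i))"
  using assms(2) by induction (simp_all add: mean_const[OF assms(1)] mean_add[OF assms(1)])

lemma mean_point: "x \<in> carrier G \<Longrightarrow> mean (\<lambda>f. f x)"
  by (simp add: mean_def)

lemma mean_mix:
  assumes "mean m" "mean m'" "0 \<le> k" "k \<le> 1"
  shows "mean (\<lambda>f. k * m f + (1 - k) * m' f)"
proof -
  have "0 \<le> k * m f + (1 - k) * m' f" if "\<forall>x\<in>carrier G. 0 \<le> f x" for f
    using assms that by (simp add: mean_def)
  then show ?thesis
    using assms by (simp add: mean_def algebra_simps)
qed

section \<open>Convolutions and the means of translates\<close>

definition convol :: "(('a \<Rightarrow> real) \<Rightarrow> real) \<Rightarrow> 'a \<Rightarrow> (('a \<Rightarrow> real) \<Rightarrow> real) \<Rightarrow> ('a \<Rightarrow> real) \<Rightarrow> real" where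
  "convol m h m' f = m (\<lambda>x. m' (\<lambda>y. f (x \<otimes> h \<otimes> y)))"

lemma mean_convol:
  assumes "mean m" "mean m'" "h \<in> carrier G"
  shows "mean (convol m h m')"
  unfolding mean_def
proof (intro conjI allI impI)
  show "0 \<le> convol m h m' f" if "\<forall>x\<in>carrier G. 0 \<le> f x" for f
    using assms that by (simp add: convol_def mean_def)
qed (simp_all add: convol_def mean_add[OF assms(1)] mean_add[OF assms(2)] mean_scale[OF assms(1)]
       mean_scale[OF assms(2)] mean_const[OF assms(1)] mean_const[OF assms(2)])

text \<open>For \<open>A\<close> inside the group and \<open>t\<close>, \<open>x\<close> in the
  group, the test says that \<open>x\<close> lies in \<open>t A\<close>, so this is
  \<open>m (t A)\<close>.\<close>

definition translate_mean :: "(('a \<Rightarrow> real) \<Rightarrow> real) \<Rightarrow> 'a set \<Rightarrow> 'a \<Rightarrow> real" where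
  "translate_mean m A t = m (\<lambda>x. of_bool (inv t \<otimes> x \<in> A))"

lemma translate_mean_le_1: "mean m \<Longrightarrow> translate_mean m A t \<le> 1"
  unfolding translate_mean_def
  using mean_mono[of m "\<lambda>x. of_bool (inv t \<otimes> x \<in> A)" "\<lambda>x. 1"] mean_const[of m 1] by simp

lemma translate_mean_ge_0: "mean m \<Longrightarrow> 0 \<le> translate_mean m A t"
  unfolding translate_mean_def by (simp add: mean_def)

lemma translate_mean_empty: "mean m \<Longrightarrow> translate_mean m {} t = 0"
  by (simp add: translate_mean_def mean_const)

lemma translate_mean_mix:
  "translate_mean (\<lambda>f. k * m f + (1 - k) * m' f) A t =
     k * translate_mean m A t + (1 - k) * translate_mean m' A t"
  by (simp add: translate_mean_def)

text \<open>\<open>x h y\<close> lies in \<open>t A\<close> exactly when \<open>y\<close> lies in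
  \<open>(inv h) (inv x) t A\<close>, so the inner mean is again that of a translate of
  \<open>A\<close>.\<close>

lemma translate_mean_convol:
  assumes "mean m" "mean m'" "h \<in> carrier G" "t \<in> carrier G"
  shows "translate_mean (convol m h m') A t = m (\<lambda>x. translate_mean m' A (inv h \<otimes> inv x \<otimes> t))"
  unfolding translate_mean_def convol_def
proof (intro mean_cong[OF assms(1)] mean_cong[OF assms(2)])
  fix x y assume "x \<in> carrier G" "y \<in> carrier G"
  then have "inv t \<otimes> (x \<otimes> h \<otimes> y) = inv (inv h \<otimes> inv x \<otimes> t) \<otimes> y"
    using assms by (simp add: inv_mult_group m_assoc)
  then show "of_bool (inv t \<otimes> (x \<otimes> h \<otimes> y) \<in> A) =
      (of_bool (inv (inv h \<otimes> inv x \<otimes> t) \<otimes> y \<in> A) :: real)"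
    by simp
qed

lemma one_le_sum_translate_mean:
  assumes "mean m" "finite I" "carrier G \<subseteq> (\<Union>i\<in>I. A i)" "t \<in> carrier G"
  shows "1 \<le> (\<Sum>i\<in>I. translate_mean m (A i) t)"
proof -
  have "1 = m (\<lambda>x. 1)" using assms by (simp add: mean_const)
  also have "\<dots> \<le> m (\<lambda>x. \<Sum>i\<in>I. of_bool (inv t \<otimes> x \<in> A i))"
  proof (rule mean_mono[OF assms(1)])
    fix x assume "x \<in> carrier G"
    then have "inv t \<otimes> x \<in> carrier G" using assms by simp
    then obtain i where "i \<in> I" "inv t \<otimes> x \<in> A i" using assms by blast
    then show "1 \<le> (\<Sum>i\<in>I. of_bool (inv t \<otimes> x \<in> A i) :: real)"
      using member_le_sum[of i I "\<lambda>i. of_bool (inv t \<otimes> x \<in> A i) :: real"] assms by simp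
  qed
  also have "\<dots> = (\<Sum>i\<in>I. translate_mean m (A i) t)"
    unfolding translate_mean_def by (rule mean_sum[OF assms(1,2)])
  finally show ?thesis .
qed

section \<open>Disjoint translates and quotient sets\<close>

lemma mem_quotient_set_iff:
  "z \<in> A <#> set_inv A \<longleftrightarrow> (\<exists>a\<in>A. \<exists>b\<in>A. z = a \<otimes> inv b)"
  by (auto simp: set_mult_def SET_INV_def)

lemma quotient_set_subset_carrier: "A \<subseteq> carrier G \<Longrightarrow> A <#> set_inv A \<subseteq> carrier G"
  by (force simp: mem_quotient_set_iff)

lemma inv_quotient_set:
  assumes "A \<subseteq> carrier G" "z \<in> A <#> set_inv A"
  shows "inv z \<in> A <#> set_inv A"
proof -
  obtain a b where ab: "a \<in> A" "b \<in> A" "z = a \<otimes> inv b"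
    using assms(2) by (auto simp: mem_quotient_set_iff)
  then have "inv z = b \<otimes> inv a" using assms(1) by (auto simp: inv_mult_group subset_iff)
  then show ?thesis using ab by (auto simp: mem_quotient_set_iff)
qed

text \<open>For \<open>A\<close> and \<open>X\<close> inside the group, \<open>x a = y b\<close> is
  equivalent to \<open>inv x y = a (inv b)\<close>; so the translates \<open>x A\<close> with
  \<open>x \<in> X\<close> are pairwise disjoint.\<close>

definition packing :: "'a set \<Rightarrow> 'a set \<Rightarrow> bool" where
  "packing A X \<longleftrightarrow> (\<forall>x\<in>X. \<forall>y\<in>X. x \<noteq> y \<longrightarrow> inv x \<otimes> y \<notin> A <#> set_inv A)"

lemma packing_sum_le_1:
  assumes "mean m" "A \<subseteq> carrier G" "finite X" "X \<subseteq> carrier G" "packing A X"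
  shows "(\<Sum>x\<in>X. translate_mean m A x) \<le> 1"
proof -
  have "(\<Sum>x\<in>X. translate_mean m A x) = m (\<lambda>z. \<Sum>x\<in>X. of_bool (inv x \<otimes> z \<in> A))"
    unfolding translate_mean_def by (rule mean_sum[OF assms(1,3), symmetric])
  also have "\<dots> \<le> m (\<lambda>z. 1)"
  proof (rule mean_mono[OF assms(1)])
    fix z assume z: "z \<in> carrier G"
    have "x = y" if "x \<in> X" "y \<in> X" "inv x \<otimes> z \<in> A" "inv y \<otimes> z \<in> A" for x y
    proof (rule ccontr)
      have "x \<in> carrier G" "y \<in> carrier G" using that assms by auto
      then have "inv x \<otimes> y = (inv x \<otimes> z) \<otimes> inv (inv y \<otimes> z)"
        using z inv_solve_left[of "inv z \<otimes> y" z y] by (simp add: inv_mult_group m_assoc)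
      then have "inv x \<otimes> y \<in> A <#> set_inv A"
        using that by (auto simp: mem_quotient_set_iff)
      moreover assume "x \<noteq> y"
      ultimately show False using that assms(5) by (auto simp: packing_def)
    qed
    then have "card {x\<in>X. inv x \<otimes> z \<in> A} \<le> 1"
      using assms(3) by (auto simp: card_le_Suc0_iff_eq)
    then show "(\<Sum>x\<in>X. of_bool (inv x \<otimes> z \<in> A) :: real) \<le> 1"
      using assms(3) by (simp add: Collect_conj_eq)
  qed
  also have "\<dots> = 1" using assms by (simp add: mean_const)
  finally show ?thesis .
qed

text \<open>Serves twice: with \<open>T\<close> the whole group, and with a \<open>T\<close> such
  that \<open>T A\<close> is the whole group, where multiplying by \<open>A\<close> on the right
  gives a cover by translates of \<open>A A\<^sup>-\<^sup>1 A\<close>.\<close>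

lemma cover_by_maximal_packing:
  assumes m: "mean m" and A: "A \<subseteq> carrier G" "A \<noteq> {}" and T: "T \<subseteq> carrier G"
    and N: "N \<ge> 1" and large: "\<And>t. t \<in> T \<Longrightarrow> 1 / real N < translate_mean m A t"
  shows "\<exists>X. X \<subseteq> carrier G \<and> finite X \<and> card X < N \<and> T \<subseteq> X <#> (A <#> set_inv A)"
proof -
  let ?P = "\<lambda>X. X \<subseteq> T \<and> finite X \<and> packing A X"
  have bound: "card X < N" if X: "?P X" for X
  \<comment> \<open>The strict inequality between sums needs a nonempty index set; for the empty
    packing \<open>N \<ge> 1\<close> suffices.\<close>
  proof (cases "X = {}")
    case False
    have "real (card X) * (1 / real N) < (\<Sum>x\<in>X. translate_mean m A x)"
      using sum_strict_mono[of X "\<lambda>_. 1 / real N" "translate_mean m A"] X False large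
      by (auto simp: subset_iff)
    also have "\<dots> \<le> 1" using X T by (intro packing_sum_le_1[OF m A(1)]) auto
    finally show ?thesis using N by (simp add: field_simps)
  qed (use N in simp)
  have "?P {}" by (simp add: packing_def)
  then obtain X where X: "?P X" and max: "\<And>Y. ?P Y \<Longrightarrow> card Y \<le> card X"
    using ex_has_greatest_nat[of ?P "{}" card N] bound less_imp_le by meson
  obtain a where a: "a \<in> A" "a \<in> carrier G" using A by blast
  have one: "\<one> \<in> A <#> set_inv A"
    unfolding mem_quotient_set_iff using a r_inv by metis
  have "t \<in> X <#> (A <#> set_inv A)" if t: "t \<in> T" for t
  proof -
    have tc: "t \<in> carrier G" using t T by blast
    have "\<exists>x\<in>X. inv x \<otimes> t \<in> A <#> set_inv A"
    proof (rule ccontr)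
      assume none: "\<not> ?thesis"
      \<comment> \<open>A packing is tested on both orders of a pair; closure of the quotient set
        under inverses supplies the second order.\<close>
      have "inv t \<otimes> x \<notin> A <#> set_inv A" if x: "x \<in> X" for x
      proof
        assume "inv t \<otimes> x \<in> A <#> set_inv A"
        from inv_quotient_set[OF A(1) this]
        have "inv x \<otimes> t \<in> A <#> set_inv A"
          using x X T tc by (auto simp: inv_mult_group subset_iff)
        then show False using none x by blast
      qed
      then have "?P (insert t X)" using X none t by (auto simp: packing_def)
      \<comment> \<open>Otherwise \<open>x = t\<close> would contradict \<open>none\<close>, since
        \<open>inv t \<otimes> t = \<one>\<close>. So the new packing is larger than the maximal
        one.\<close>
      moreover have "t \<notin> X" using none one tc by auto
      ultimately show False using max[of "insert t X"] X by simp
    qed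
    then obtain x where x: "x \<in> X" "inv x \<otimes> t \<in> A <#> set_inv A" by blast
    then have "t = x \<otimes> (inv x \<otimes> t)"
      using X T tc by (metis inv_closed inv_inv l_inv l_one m_assoc subsetD)
    then show ?thesis using x unfolding set_mult_def by blast
  qed
  then show ?thesis using X T bound[OF X] by blast
qed

section \<open>Lowering the supremum over translates\<close>

definition large_translates :: "(('a \<Rightarrow> real) \<Rightarrow> real) \<Rightarrow> 'a set \<Rightarrow> real \<Rightarrow> 'a set" where
  "large_translates m A c = {t \<in> carrier G. c < translate_mean m A t}"

text \<open>\<open>Q\<close> stands for bounds already secured on other cells. Being stable under
  mixtures and left convolutions, it lets a nearly optimal mean be improved without leaving
  \<open>Q\<close>.\<close>

lemma translate_mean_descent:
  assumes Q: "Q m0" "\<And>m. Q m \<Longrightarrow> mean m"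
    and mix: "\<And>m m' k. Q m \<Longrightarrow> Q m' \<Longrightarrow> 0 \<le> k \<Longrightarrow> k \<le> 1 \<Longrightarrow> Q (\<lambda>f. k * m f + (1 - k) * m' f)"
    and convol: "\<And>m m' h. mean m \<Longrightarrow> Q m' \<Longrightarrow> h \<in> carrier G \<Longrightarrow> Q (convol m h m')"
    and A: "A \<subseteq> carrier G"
    and c: "0 \<le> c"
    and nocover: "\<And>m. Q m \<Longrightarrow> large_translates m A c <#> A \<noteq> carrier G"
    and \<epsilon>: "0 < \<epsilon>"
  shows "\<exists>m. Q m \<and> (\<forall>t\<in>carrier G. translate_mean m A t \<le> c + \<epsilon>)"
proof -
  define B where "B = {b. \<exists>m. Q m \<and> (\<forall>t\<in>carrier G. translate_mean m A t \<le> b)}"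
  define s where "s = Inf B"
  have B1: "1 \<in> B" using Q translate_mean_le_1 unfolding B_def by blast
  have "0 \<le> b" if "b \<in> B" for b
    using that Q(2) translate_mean_ge_0 one_closed unfolding B_def by (smt (verit) mem_Collect_eq)
  then have bdd: "bdd_below B" by (auto simp: bdd_below_def)
  have lower: "s \<le> b" if "b \<in> B" for b
    unfolding s_def using that bdd by (rule cInf_lower)
  have approx: "\<exists>b\<in>B. b < u" if "s < u" for u
    using that B1 cInf_lessD[of B u] unfolding s_def by blast
  have "s \<le> c"
  proof (rule ccontr)
    assume "\<not> s \<le> c"
    then have sc: "c < s" by simp
    \<comment> \<open>The improvement below replaces a bound \<open>b\<close> by
      \<open>b / (1 + (b - c))\<close>. As \<open>s \<le> b\<close>, the result falls below
      \<open>s\<close> once \<open>b < s * (1 + (s - c))\<close>.\<close>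
    then have "s < s * (1 + (s - c))" using c by simp
    then obtain b where b: "b \<in> B" "b < s * (1 + (s - c))" using approx by blast
    have sb: "s \<le> b" using lower b by blast
    obtain m where m: "Q m" and mb: "\<And>t. t \<in> carrier G \<Longrightarrow> translate_mean m A t \<le> b"
      using b unfolding B_def by blast
    have mm: "mean m" using Q(2) m .
    have "large_translates m A c <#> A \<subseteq> carrier G"
      using A by (auto simp: set_mult_def large_translates_def)
    then obtain g where g: "g \<in> carrier G" "g \<notin> large_translates m A c <#> A"
      using nocover[OF m] by blast
    have small: "translate_mean m A (g \<otimes> inv a) \<le> c" if a: "a \<in> A" for a
    proof (rule ccontr)
      assume "\<not> ?thesis"
      then have "g \<otimes> inv a \<in> large_translates m A c"
        using a A g by (auto simp: large_translates_def)
      moreover have "g = (g \<otimes> inv a) \<otimes> a" using a A g by (auto simp: m_assoc subset_iff)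
      ultimately show False using g a unfolding set_mult_def by blast
    qed
    define m' where "m' = convol m (inv g) m"
    have m': "Q m'" unfolding m'_def using convol mm m g by simp
    have t': "translate_mean m' A t \<le> b - (b - c) * translate_mean m A t"
      if t: "t \<in> carrier G" for t
    proof -
      have "translate_mean m' A t = m (\<lambda>x. translate_mean m A (g \<otimes> inv x \<otimes> t))"
        unfolding m'_def using translate_mean_convol[OF mm mm, of "inv g"] g t by simp
      \<comment> \<open>If \<open>a = inv t \<otimes> x\<close> lies in \<open>A\<close>, the
        translate is by \<open>g \<otimes> inv a\<close> and \<open>small\<close> gives
        \<open>c\<close>; otherwise only the bound \<open>b\<close> is available.\<close>
      also have "\<dots> \<le> m (\<lambda>x. b - (b - c) * of_bool (inv t \<otimes> x \<in> A))"
      proof (rule mean_mono[OF mm])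
        fix x assume x: "x \<in> carrier G"
        have "g \<otimes> inv x \<otimes> t = g \<otimes> inv (inv t \<otimes> x)"
          using x t g by (simp add: inv_mult_group m_assoc)
        then show "translate_mean m A (g \<otimes> inv x \<otimes> t) \<le> b - (b - c) * of_bool (inv t \<otimes> x \<in> A)"
          using small[of "inv t \<otimes> x"] mb[of "g \<otimes> inv x \<otimes> t"] x t g by simp
      qed
      also have "\<dots> = b - (b - c) * translate_mean m A t"
        unfolding translate_mean_def by (simp add: mean_diff[OF mm] mean_const[OF mm] mean_scale[OF mm])
      finally show ?thesis .
    qed
    define d where "d = b - c"
    \<comment> \<open>The weight solves \<open>(1 - k) * d = k\<close>: the terms in
      \<open>translate_mean m A t\<close> cancel, leaving \<open>(1 - k) * b\<close> for every
      \<open>t\<close>.\<close>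
    define k where "k = d / (1 + d)"
    have d: "0 < d" using sc sb by (simp add: d_def)
    then have k: "0 \<le> k" "k \<le> 1" by (auto simp: k_def field_simps)
    have k1: "1 - k = 1 / (1 + d)" using d by (simp add: k_def field_simps)
    then have kd: "(1 - k) * d = k" by (simp add: k_def)
    define m'' where "m'' = (\<lambda>f. k * m f + (1 - k) * m' f)"
    have "translate_mean m'' A t \<le> b / (1 + d)" if t: "t \<in> carrier G" for t
    proof -
      have "translate_mean m'' A t = k * translate_mean m A t + (1 - k) * translate_mean m' A t"
        unfolding m''_def by (rule translate_mean_mix)
      also have "\<dots> \<le> k * translate_mean m A t + (1 - k) * (b - d * translate_mean m A t)"
        using t'[OF t] k by (simp add: mult_left_mono d_def)
      also have "\<dots> = (1 - k) * b + (k - (1 - k) * d) * translate_mean m A t"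
        by (simp add: algebra_simps)
      also have "\<dots> = b / (1 + d)" unfolding kd by (simp add: k1)
      finally show ?thesis .
    qed
    moreover have "Q m''" unfolding m''_def using mix m m' k by blast
    ultimately have "b / (1 + d) \<in> B" unfolding B_def by blast
    then have "s \<le> b / (1 + d)" by (rule lower)
    then have "s * (1 + d) \<le> b" using d by (simp add: field_simps)
    moreover have "s * (1 + (s - c)) \<le> s * (1 + d)"
      using sb sc c by (intro mult_left_mono) (auto simp: d_def)
    ultimately show False using b by linarith
  qed
  then have "s < c + \<epsilon>" using \<epsilon> by simp
  then obtain b where "b \<in> B" "b < c + \<epsilon>" using approx by blast
  then show ?thesis unfolding B_def by (force intro: order_trans)
qed

text \<open>Induction on the cells. The slack \<epsilon> does not accumulate, because the descent
  for a new cell keeps the earlier bounds unchanged.\<close>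

lemma mean_with_small_translates:
  assumes "finite J" and "\<And>j. j \<in> J \<Longrightarrow> A j \<subseteq> carrier G" and "0 \<le> c" and "0 < \<epsilon>"
    and "\<And>m j. mean m \<Longrightarrow> j \<in> J \<Longrightarrow> large_translates m (A j) c <#> A j \<noteq> carrier G"
  shows "\<exists>m. mean m \<and> (\<forall>j\<in>J. \<forall>t\<in>carrier G. translate_mean m (A j) t \<le> c + \<epsilon>)"
  using assms(1,2,5)
proof (induction J rule: finite_induct)
  case empty
  then show ?case by (auto intro!: exI[of _ "\<lambda>f. f \<one>"] mean_point)
next
  case (insert i J)
  define Q where
    "Q = (\<lambda>m. mean m \<and> (\<forall>j\<in>J. \<forall>t\<in>carrier G. translate_mean m (A j) t \<le> c + \<epsilon>))"
  have "\<exists>m. Q m" unfolding Q_def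
    by (rule insert.IH) (use insert.prems in simp_all)
  then obtain m0 where m0: "Q m0" ..
  have "\<exists>m. Q m \<and> (\<forall>t\<in>carrier G. translate_mean m (A i) t \<le> c + \<epsilon>)"
  proof (rule translate_mean_descent[where Q = Q, OF m0])
    show "Q (\<lambda>f. k * m f + (1 - k) * m' f)" if "Q m" "Q m'" "0 \<le> k" "k \<le> 1" for m m' k
      using that mean_mix[of m m' k]
        convex_bound_le[of "translate_mean m _ _" "c + \<epsilon>" "translate_mean m' _ _" k "1 - k"]
      unfolding Q_def by (simp add: translate_mean_mix)
    show "Q (convol m h m')" if m: "mean m" and m': "Q m'" and h: "h \<in> carrier G" for m m' h
    proof -
      have mm': "mean m'"
        and bound: "\<And>j t. j \<in> J \<Longrightarrow> t \<in> carrier G \<Longrightarrow> translate_mean m' (A j) t \<le> c + \<epsilon>"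
        using m' unfolding Q_def by blast+
      have "translate_mean (convol m h m') (A j) t \<le> c + \<epsilon>" if "j \<in> J" "t \<in> carrier G" for j t
      proof -
        have "translate_mean (convol m h m') (A j) t =
            m (\<lambda>x. translate_mean m' (A j) (inv h \<otimes> inv x \<otimes> t))"
          using translate_mean_convol[OF m mm' h that(2)] .
        also have "\<dots> \<le> m (\<lambda>x. c + \<epsilon>)"
          by (rule mean_mono[OF m], rule bound) (use h that in simp_all)
        also have "\<dots> = c + \<epsilon>" using m by (rule mean_const)
        finally show ?thesis .
      qed
      then show ?thesis using mean_convol[OF m mm' h] unfolding Q_def by blast
    qed
    show "mean m" if "Q m" for m using that unfolding Q_def by blast
    then show "large_translates m (A i) c <#> A i \<noteq> carrier G" if "Q m" for m
      using insert.prems(2)[of m i] that by blast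
  qed (use insert.prems(1) assms(3,4) in blast)+
  then show ?case unfolding Q_def by blast
qed

end

section \<open>The two alternatives for a partition\<close>

theorem corollary2:
  fixes G :: "('a, 'b) monoid_scheme" and A :: "nat \<Rightarrow> 'a set" and n :: nat
  assumes "group G"
    and "n \<ge> 1"
    and "carrier G = (\<Union>i\<in>{1..n}. A i)"
    and "disjoint_family_on A {1..n}"
  shows "(\<forall>i\<in>{1..n}. card_at_most (covering_number G (A i <#>\<^bsub>G\<^esub> set_inv\<^bsub>G\<^esub> (A i))) n) \<or>
         (\<exists>i\<in>{1..n}. card_less_than
            (covering_number G ((A i <#>\<^bsub>G\<^esub> set_inv\<^bsub>G\<^esub> (A i)) <#>\<^bsub>G\<^esub> A i)) n)"
proof -
  interpret group G by fact
  have sub: "A i \<subseteq> carrier G" if "i \<in> {1..n}" for i using assms(3) that by blast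
  let ?D = "\<lambda>i. A i <#>\<^bsub>G\<^esub> set_inv\<^bsub>G\<^esub> (A i)"
  show ?thesis
  proof (cases "\<exists>m. \<exists>j\<in>{1..n}. mean m \<and> large_translates m (A j) (1 / real n) <#>\<^bsub>G\<^esub> A j = carrier G")
    case True
    then obtain m j where j: "j \<in> {1..n}" and m: "mean m"
      and cover: "large_translates m (A j) (1 / real n) <#>\<^bsub>G\<^esub> A j = carrier G" by blast
    let ?T = "large_translates m (A j) (1 / real n)"
    have Tc: "?T \<subseteq> carrier G" by (auto simp: large_translates_def)
    \<comment> \<open>Cells may be empty, so nonemptiness has to come from the cover.\<close>
    have ne: "A j \<noteq> {}" using cover one_closed by (auto simp: set_mult_def)
    obtain X where X: "X \<subseteq> carrier G" "finite X" "card X < n" "?T \<subseteq> X <#>\<^bsub>G\<^esub> ?D j"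
      using cover_by_maximal_packing[OF m sub[OF j] ne Tc assms(2)]
      by (auto simp: large_translates_def)
    have Dc: "?D j \<subseteq> carrier G" using quotient_set_subset_carrier[OF sub[OF j]] .
    have DAc: "?D j <#>\<^bsub>G\<^esub> A j \<subseteq> carrier G" using Dc sub[OF j] set_mult_closed by blast
    have "carrier G \<subseteq> (X <#>\<^bsub>G\<^esub> ?D j) <#>\<^bsub>G\<^esub> A j"
      using cover X(4) by (metis mono_set_mult order_refl)
    also have "\<dots> = X <#>\<^bsub>G\<^esub> (?D j <#>\<^bsub>G\<^esub> A j)"
      by (rule set_mult_assoc[OF X(1) Dc sub[OF j]])
    finally have eq: "carrier G = X <#>\<^bsub>G\<^esub> (?D j <#>\<^bsub>G\<^esub> A j)"
      using set_mult_closed[OF X(1) DAc] by blast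
    moreover have "?D j <#>\<^bsub>G\<^esub> A j \<noteq> {}" using eq one_closed by (auto simp: set_mult_def)
    ultimately have "card_less_than (covering_number G (?D j <#>\<^bsub>G\<^esub> A j)) n"
      using card_less_than_covering_number_iff[OF assms(1) DAc] X by blast
    then show ?thesis using j by blast
  next
    case False
    have "card_at_most (covering_number G (?D i)) n" if i: "i \<in> {1..n}" for i
    proof -
      let ?J = "{1..n} - {i}"
      \<comment> \<open>Solves \<open>1/n - (n - 1) \<epsilon> = 1/(n + 1) + \<epsilon>\<close>:
        after the other \<open>n - 1\<close> cells take their share, the mean of
        \<open>t A\<^sub>i\<close> still exceeds \<open>1/(n + 1)\<close> strictly.\<close>
      define \<epsilon> where "\<epsilon> = 1 / (real n * real n * (real n + 1))"
      have "0 < \<epsilon>" using assms(2) by (simp add: \<epsilon>_def)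
      then obtain m where m: "mean m"
        and small: "\<And>j t. j \<in> ?J \<Longrightarrow> t \<in> carrier G \<Longrightarrow> translate_mean m (A j) t \<le> 1 / real n + \<epsilon>"
        using mean_with_small_translates[of ?J A "1 / real n" \<epsilon>] sub False by auto
      have large: "1 / real (Suc n) < translate_mean m (A i) t" if t: "t \<in> carrier G" for t
      proof -
        have "1 \<le> (\<Sum>j\<in>{1..n}. translate_mean m (A j) t)"
          using one_le_sum_translate_mean[OF m, of "{1..n}" A t] assms(3) t by simp
        also have "\<dots> = translate_mean m (A i) t + (\<Sum>j\<in>?J. translate_mean m (A j) t)"
          using i by (simp add: sum.remove)
        also have "(\<Sum>j\<in>?J. translate_mean m (A j) t) \<le> (\<Sum>j\<in>?J. 1 / real n + \<epsilon>)"
          by (rule sum_mono) (use small t in blast)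
        also have "\<dots> = (real n - 1) * (1 / real n + \<epsilon>)"
          using i assms(2) by (simp add: of_nat_diff)
        finally have "1 - (real n - 1) * (1 / real n + \<epsilon>) \<le> translate_mean m (A i) t" by simp
        moreover have "1 - (real n - 1) * (1 / real n + \<epsilon>) = 1 / (real n + 1) + \<epsilon>"
          using assms(2) unfolding \<epsilon>_def by (simp add: divide_simps) (simp add: algebra_simps)
        ultimately show ?thesis using \<open>0 < \<epsilon>\<close> by (simp add: add.commute)
      qed
      have "0 < translate_mean m (A i) \<one>\<^bsub>G\<^esub>"
        using large[OF one_closed] by (smt (verit) of_nat_0_le_iff zero_le_divide_1_iff)
      then have ne: "A i \<noteq> {}" using translate_mean_empty[OF m] by auto
      \<comment> \<open>With \<open>N = Suc n\<close> the strict bound on \<open>card X\<close>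
        becomes \<open>card X \<le> n\<close>.\<close>
      obtain X where X: "X \<subseteq> carrier G" "finite X" "card X < Suc n" "carrier G \<subseteq> X <#>\<^bsub>G\<^esub> ?D i"
        using cover_by_maximal_packing[OF m sub[OF i] ne order_refl, of "Suc n"] large by auto
      have Dc: "?D i \<subseteq> carrier G" using quotient_set_subset_carrier[OF sub[OF i]] .
      have "carrier G = X <#>\<^bsub>G\<^esub> ?D i" using X(4) set_mult_closed[OF X(1) Dc] by blast
      moreover have "?D i \<noteq> {}" using X(4) one_closed by (auto simp: set_mult_def)
      ultimately show ?thesis
        using card_at_most_covering_number_iff[OF assms(1) Dc] X by (auto simp: less_Suc_eq_le)
    qed
    then show ?thesis by blast
  qed
qed

end
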